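(* Let $p_1>q_1>0$ and $p_2>q_2>0$ be real numbers, $m,n\ge 0$ integers, and $\mathbf{P}_{i,j}\in\mathbb{R}^3$ for $0\le i\le m$, $0\le j\le n$. The tensor product $(p,q)$-Bézier surface $$\mathbf{P}(u,v)=\sum_{i=0}^{m}\sum_{j=0}^{n}\mathbf{P}_{i,j}\,B^{i,m}_{p_1,q_1}(u)\,B^{j,n}_{p_2,q_2}(v),\qquad (u,v)\in[0,1]\times[0,1],$$ has the following properties. (1) Geometric and affine invariance: $\sum_{i=0}^{m}\sum_{j=0}^{n}B^{i,m}_{p_1,q_1}(u)B^{j,n}_{p_2,q_2}(v)=1$ for all $(u,v)\in[0,1]^2$, so $\mathbf{P}(u,v)$ is an affine combination of its control points. (2) Convex hull property: $\mathbf{P}(u,v)$ is a convex combination of the $\mathbf{P}_{i,j}$ and lies in the convex hull of its control net, for all $(u,v)\in[0,1]^2$. (3) Isoparametric curves: for fixed $v^\ast,u^\ast\in[0,1]$ the isoparametric curves $v=v^\ast$ and $u=u^\ast$ are $(p,q)$-Bézier curves of degree $m$ and $n$ respectively, namely $\mathbf{P}(u,v^\ast)=\sum_{i=0}^{m}\big(\sum_{j=0}^{n}\mathbf{P}_{i,j}B^{j,n}_{p_2,q_2}(v^\ast)\big)B^{i,m}_{p_1,q_1}(u)$ for $u\in[0,1]$, and $\mathbf{P}(u^\ast,v)=\sum_{j=0}^{n}\big(\sum_{i=0}^{m}\mathbf{P}_{i,j}B^{i,m}_{p_1,q_1}(u^\ast)\big)B^{j,n}_{p_2,q_2}(v)$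 for $v\in[0,1]$. (4) Corner point interpolation: $\mathbf{P}(0,0)=\mathbf{P}_{0,0}$, $\mathbf{P}(0,1)=\mathbf{P}_{0,n}$, $\mathbf{P}(1,0)=\mathbf{P}_{m,0}$, $\mathbf{P}(1,1)=\mathbf{P}_{m,n}$. (5) Reducibility: when $p_1=p_2=1$, $\mathbf{P}(u,v)$ is the tensor product $q$-Bézier surface, i.e. the surface given by the same formula with $B^{i,m}_{p_1,q_1}(u)$ and $B^{j,n}_{p_2,q_2}(v)$ replaced by $\begin{bmatrix} m\\ i\end{bmatrix}_{q_1}u^{i}\prod_{s=0}^{m-i-1}(1-q_1^{s}u)$ and $\begin{bmatrix} n\\ j\end{bmatrix}_{q_2}v^{j}\prod_{s=0}^{n-j-1}(1-q_2^{s}v)$.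
   Context: For real $p>q>0$ and integers $n\ge 0$, the $(p,q)$-integers are $[n]_{p,q}=\frac{p^n-q^n}{p-q}$; $[n]_{p,q}!=[1]_{p,q}[2]_{p,q}\cdots[n]_{p,q}$ with $[0]_{p,q}!=1$; and for $0\le k\le n$ the $(p,q)$-binomial coefficient is $\begin{bmatrix} n\\ k\end{bmatrix}_{p,q}=\frac{[n]_{p,q}!}{[k]_{p,q}!\,[n-k]_{p,q}!}$. The $q$-binomial coefficient $\begin{bmatrix} n\\ k\end{bmatrix}_{q}$ is the usual Gaussian binomial coefficient, built in the same way from $[n]_q=\frac{1-q^n}{1-q}$. The $(p,q)$-Bernstein functions of degree $n$ are, for $0\le k\le n$ and $t\in[0,1]$, $$B^{k,n}_{p,q}(t)=\frac{1}{p^{n(n-1)/2}}\begin{bmatrix} n\\ k\end{bmatrix}_{p,q}p^{k(k-1)/2}\,t^{k}\prod_{s=0}^{n-k-1}(p^{s}-q^{s}t),$$ where an empty product equals $1$. A $(p,q)$-Bézier curve of degree $n$ is a curve $t\mapsto\sum_{k=0}^n\mathbf{Q}_kB^{k,n}_{p,q}(t)$ on $[0,1]$ with $\mathbf{Q}_k\in\mathbb{R}^3$. The points $\mathbf{P}_{i,j}$ are the control points of the surface; its control net is obtained by joining adjacent control points in the same row or column. *)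

theory Defs
  imports "HOL-Analysis.Analysis"
begin

definition pq_int :: "real \<Rightarrow> real \<Rightarrow> nat \<Rightarrow> real" where
  "pq_int p q n = (p ^ n - q ^ n) / (p - q)"

definition pq_fact :: "real \<Rightarrow> real \<Rightarrow> nat \<Rightarrow> real" where
  "pq_fact p q n = (\<Prod>i = 1..n. pq_int p q i)"

text \<open>The binomial coefficients and the Bernstein functions below are meaningful only for
  \<open>k \<le> n\<close> (natural-number subtraction truncates); they are used only in that range.\<close>

definition pq_binomial :: "real \<Rightarrow> real \<Rightarrow> nat \<Rightarrow> nat \<Rightarrow> real" where
  "pq_binomial p q n k = pq_fact p q n / (pq_fact p q k * pq_fact p q (n - k))"

definition pq_bernstein :: "real \<Rightarrow> real \<Rightarrow> nat \<Rightarrow> nat \<Rightarrow> real \<Rightarrow> real" where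
  "pq_bernstein p q n k t =
     1 / p ^ (n * (n - 1) div 2) * pq_binomial p q n k * p ^ (k * (k - 1) div 2) * t ^ k *
     (\<Prod>s < n - k. p ^ s - q ^ s * t)"

definition q_int :: "real \<Rightarrow> nat \<Rightarrow> real" where
  "q_int q n = (1 - q ^ n) / (1 - q)"

definition q_fact :: "real \<Rightarrow> nat \<Rightarrow> real" where
  "q_fact q n = (\<Prod>i = 1..n. q_int q i)"

definition q_binomial :: "real \<Rightarrow> nat \<Rightarrow> nat \<Rightarrow> real" where
  "q_binomial q n k = q_fact q n / (q_fact q k * q_fact q (n - k))"

definition q_bernstein :: "real \<Rightarrow> nat \<Rightarrow> nat \<Rightarrow> real \<Rightarrow> real" where
  "q_bernstein q n k t = q_binomial q n k * t ^ k * (\<Prod>s < n - k. 1 - q ^ s * t)"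

definition pq_bezier_curve :: "real \<Rightarrow> real \<Rightarrow> nat \<Rightarrow> (nat \<Rightarrow> real ^ 3) \<Rightarrow> real \<Rightarrow> real ^ 3" where
  "pq_bezier_curve p q n Q t = (\<Sum>k\<le>n. pq_bernstein p q n k t *\<^sub>R Q k)"

definition is_pq_bezier_curve :: "real \<Rightarrow> real \<Rightarrow> nat \<Rightarrow> (real \<Rightarrow> real ^ 3) \<Rightarrow> bool" where
  "is_pq_bezier_curve p q n c \<longleftrightarrow> (\<exists>Q. \<forall>t\<in>{0..1}. c t = pq_bezier_curve p q n Q t)"

definition pq_bezier_surface ::
  "real \<Rightarrow> real \<Rightarrow> real \<Rightarrow> real \<Rightarrow> nat \<Rightarrow> nat \<Rightarrow> (nat \<Rightarrow> nat \<Rightarrow> real ^ 3) \<Rightarrow> real \<Rightarrow> real \<Rightarrow> real ^ 3" where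
  "pq_bezier_surface p1 q1 p2 q2 m n P u v =
     (\<Sum>i\<le>m. \<Sum>j\<le>n. (pq_bernstein p1 q1 m i u * pq_bernstein p2 q2 n j v) *\<^sub>R P i j)"

definition q_bezier_surface ::
  "real \<Rightarrow> real \<Rightarrow> nat \<Rightarrow> nat \<Rightarrow> (nat \<Rightarrow> nat \<Rightarrow> real ^ 3) \<Rightarrow> real \<Rightarrow> real \<Rightarrow> real ^ 3" where
  "q_bezier_surface q1 q2 m n P u v =
     (\<Sum>i\<le>m. \<Sum>j\<le>n. (q_bernstein q1 m i u * q_bernstein q2 n j v) *\<^sub>R P i j)"

definition affine_combination ::
  "('i \<Rightarrow> real) \<Rightarrow> 'i set \<Rightarrow> ('i \<Rightarrow> 'a::real_vector) \<Rightarrow> 'a \<Rightarrow> bool" where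
  "affine_combination w I a x \<longleftrightarrow>
     finite I \<and> (\<Sum>i\<in>I. w i) = 1 \<and> x = (\<Sum>i\<in>I. w i *\<^sub>R a i)"

definition convex_combination ::
  "('i \<Rightarrow> real) \<Rightarrow> 'i set \<Rightarrow> ('i \<Rightarrow> 'a::real_vector) \<Rightarrow> 'a \<Rightarrow> bool" where
  "convex_combination w I a x \<longleftrightarrow> affine_combination w I a x \<and> (\<forall>i\<in>I. 0 \<le> w i)"

text \<open>The control points are listed separately because for \<open>m = n = 0\<close> the net has no edges.\<close>

definition control_net :: "nat \<Rightarrow> nat \<Rightarrow> (nat \<Rightarrow> nat \<Rightarrow> real ^ 3) \<Rightarrow> (real ^ 3) set" where
  "control_net m n P =
     (\<Union>i\<le>m. \<Union>j\<le>n. {P i j})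
     \<union> (\<Union>i<m. \<Union>j\<le>n. closed_segment (P i j) (P (Suc i) j))
     \<union> (\<Union>i\<le>m. \<Union>j<n. closed_segment (P i j) (P i (Suc j)))"

end

(*
  By the Pascal recurrence [n+1, k] = p^k [n, k] + q^(n+1-k) [n, k-1], the unnormalised sum
  S(n) = \<Sum>k. [n, k] p^(k(k-1)/2) t^k \<Prod>s<n-k. (p^s - q^s t) satisfies S(n+1) = p^n S(n):
  the term with index k of S(n) is multiplied by (p^n - p^k q^(n-k) t) from the first summand of
  the recurrence and by p^k q^(n-k) t from the second. Hence S(n) = p^(n(n-1)/2), so the
  Bernstein functions are a partition of unity. They are nonnegative on [0, 1] as p^s \<ge> q^s t
  there, and at both ends of [0, 1] all but one of them vanish.
*)
theory Submission
  imports Defs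
begin

lemma pq_int_pos:
  assumes "p > q" "q > 0" "n > 0"
  shows "pq_int p q n > 0"
  using assms power_strict_mono[of q p n] by (simp add: pq_int_def)

lemma pq_fact_pos:
  assumes "p > q" "q > 0"
  shows "pq_fact p q n > 0"
  unfolding pq_fact_def using assms by (intro prod_pos) (auto intro: pq_int_pos)

lemma pq_fact_0 [simp]: "pq_fact p q 0 = 1"
  by (simp add: pq_fact_def)

lemma pq_fact_Suc: "pq_fact p q (Suc n) = pq_int p q (Suc n) * pq_fact p q n"
  by (simp add: pq_fact_def)

lemma pq_binomial_nonneg:
  assumes "p > q" "q > 0"
  shows "pq_binomial p q n k \<ge> 0"
  using pq_fact_pos[OF assms] by (simp add: pq_binomial_def less_imp_le)

lemma pq_binomial_0:
  assumes "p > q" "q > 0"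
  shows "pq_binomial p q n 0 = 1"
  using pq_fact_pos[OF assms, of n] by (simp add: pq_binomial_def)

lemma pq_binomial_self:
  assumes "p > q" "q > 0"
  shows "pq_binomial p q n n = 1"
  using pq_fact_pos[OF assms, of n] by (simp add: pq_binomial_def)

text \<open>Insert the mixed term \<open>p ^ k * q ^ l\<close>: the numerator is
  \<open>p ^ k * (p ^ l - q ^ l) + q ^ l * (p ^ k - q ^ k)\<close>.\<close>

lemma pq_int_add: "pq_int p q (k + l) = p ^ k * pq_int p q l + q ^ l * pq_int p q k"
  by (simp add: pq_int_def power_add algebra_simps flip: add_divide_distrib)

text \<open>The leading factor of \<open>pq_fact p q (Suc n)\<close> is split by
  \<open>pq_int_add\<close> along n + 1 = (k + 1) + (n - k); each summand then cancels the top
  factor of one factorial in the denominator.\<close>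

lemma pq_binomial_pascal:
  assumes "p > q" "q > 0" "k < n"
  shows "pq_binomial p q (Suc n) (Suc k) =
    p ^ Suc k * pq_binomial p q n (Suc k) + q ^ (n - k) * pq_binomial p q n k"
proof -
  obtain l where n: "n = Suc (k + l)"
    using \<open>k < n\<close> less_iff_Suc_add by auto
  have nz: "pq_fact p q j \<noteq> 0" "pq_int p q (Suc j) \<noteq> 0" for j
    using pq_fact_pos[OF assms(1,2), of j] pq_int_pos[OF assms(1,2), of "Suc j"] by auto
  have split: "pq_int p q (Suc n) = p ^ Suc k * pq_int p q (Suc l) + q ^ Suc l * pq_int p q (Suc k)"
    using pq_int_add[of p q "Suc k" "Suc l"] by (simp add: n)
  have "pq_binomial p q (Suc n) (Suc k) =
      pq_int p q (Suc n) * pq_fact p q n / (pq_fact p q (Suc k) * pq_fact p q (Suc l))"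
    by (simp add: pq_binomial_def n pq_fact_Suc)
  also have "\<dots> = p ^ Suc k * (pq_fact p q n / (pq_fact p q (Suc k) * pq_fact p q l))
      + q ^ Suc l * (pq_fact p q n / (pq_fact p q k * pq_fact p q (Suc l)))"
    unfolding split pq_fact_Suc[of p q k] pq_fact_Suc[of p q l]
    using nz[of k] nz[of l] by (simp add: field_simps)
  also have "\<dots> = p ^ Suc k * pq_binomial p q n (Suc k) + q ^ (n - k) * pq_binomial p q n k"
    by (simp add: pq_binomial_def n)
  finally show ?thesis .
qed

text \<open>Each entry of row \<open>n\<close> feeds two neighbours in row \<open>Suc n\<close>, so
  the sum can be regrouped by the entry of origin. The two border entries have their own assumptions
  because \<open>f\<close> need not vanish outside its triangle: with truncated subtraction,
  \<open>pq_binomial p q n (Suc n)\<close> is not 0.\<close>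

lemma sum_atMost_Suc_pascal:
  fixes f :: "nat \<Rightarrow> nat \<Rightarrow> 'a::comm_semiring_1"
  assumes "f (Suc n) 0 = a 0 * f n 0" "f (Suc n) (Suc n) = b n * f n n"
    and "\<And>k. k < n \<Longrightarrow> f (Suc n) (Suc k) = a (Suc k) * f n (Suc k) + b k * f n k"
  shows "(\<Sum>k\<le>Suc n. f (Suc n) k * g k) = (\<Sum>k\<le>n. f n k * (a k * g k + b k * g (Suc k)))"
proof -
  have "(\<Sum>k\<le>Suc n. f (Suc n) k * g k) =
      a 0 * f n 0 * g 0 + (\<Sum>k<n. (a (Suc k) * f n (Suc k) + b k * f n k) * g (Suc k))
      + b n * f n n * g (Suc n)"
    by (subst sum.atMost_Suc_shift, subst lessThan_Suc_atMost [symmetric],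
        subst sum.lessThan_Suc) (simp add: assms add.assoc)
  also have "\<dots> = (a 0 * f n 0 * g 0 + (\<Sum>k<n. a (Suc k) * f n (Suc k) * g (Suc k)))
      + ((\<Sum>k<n. b k * f n k * g (Suc k)) + b n * f n n * g (Suc n))"
    by (simp add: sum.distrib algebra_simps)
  \<comment> \<open>The border term at 0 completes the \<open>a\<close>-sum, the one at
    \<open>n\<close> the \<open>b\<close>-sum.\<close>
  also have "\<dots> = (\<Sum>k<Suc n. a k * f n k * g k) + (\<Sum>k<Suc n. b k * f n k * g (Suc k))"
    by (simp only: sum.lessThan_Suc_shift[of "\<lambda>k. a k * f n k * g k"]
        sum.lessThan_Suc[of "\<lambda>k. b k * f n k * g (Suc k)"] o_def)
  also have "\<dots> = (\<Sum>k\<le>n. f n k * (a k * g k + b k * g (Suc k)))"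
    by (simp add: lessThan_Suc_atMost sum.distrib algebra_simps)
  finally show ?thesis .
qed

text \<open>Read as binomial coefficients, this is Pascal's rule for n + 1 over 2, which avoids
  parity arguments about \<open>div\<close>.\<close>

lemma triangle_Suc: "Suc n * (Suc n - 1) div 2 = n * (n - 1) div 2 + n"
  using choose_two[of n] choose_two[of "Suc n"] by (simp add: numeral_2_eq_2)

lemma sum_pq_binomial_prod:
  assumes "p > q" "q > 0"
  shows "(\<Sum>k\<le>n. pq_binomial p q n k *
           (p ^ (k * (k - 1) div 2) * t ^ k * (\<Prod>s<n - k. p ^ s - q ^ s * t)))
         = p ^ (n * (n - 1) div 2)"
proof (induction n)
  case 0
  show ?case by (simp add: pq_binomial_def)
next
  case (Suc n)
  let ?g = "\<lambda>n k. p ^ (k * (k - 1) div 2) * t ^ k * (\<Prod>s<n - k. p ^ s - q ^ s * t)"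
  have step: "p ^ k * ?g (Suc n) k + q ^ (n - k) * ?g (Suc n) (Suc k) = p ^ n * ?g n k"
    if "k \<le> n" for k
  proof -
    \<comment> \<open>The product gains the factor with s = n - k, and
      \<open>p ^ k * p ^ (n - k)\<close> is \<open>p ^ n\<close>.\<close>
    have "p ^ k * ?g (Suc n) k = ?g n k * (p ^ n - p ^ k * q ^ (n - k) * t)"
      using that by (simp add: Suc_diff_le algebra_simps flip: power_add)
    \<comment> \<open>Here the product is unchanged, as \<open>Suc n - Suc k\<close> is
      \<open>n - k\<close>; the triangular exponent grows by \<open>k\<close> and
      \<open>t ^ k\<close> gains one \<open>t\<close>.\<close>
    moreover have "q ^ (n - k) * ?g (Suc n) (Suc k) = ?g n k * (p ^ k * q ^ (n - k) * t)"
      unfolding triangle_Suc by (simp add: power_add)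
    ultimately show ?thesis by (simp only: distrib_left right_diff_distrib) (simp add: mult.commute)
  qed
  have "(\<Sum>k\<le>Suc n. pq_binomial p q (Suc n) k * ?g (Suc n) k)
      = (\<Sum>k\<le>n. pq_binomial p q n k * (p ^ k * ?g (Suc n) k + q ^ (n - k) * ?g (Suc n) (Suc k)))"
    \<comment> \<open>The coefficients are a(k) = \<open>p ^ k\<close> and b(k) =
      \<open>q ^ (n - k)\<close>; a(0) = b(n) = 1 fits the border entries.\<close>
    by (rule sum_atMost_Suc_pascal)
      (use assms in \<open>simp_all add: pq_binomial_0 pq_binomial_self pq_binomial_pascal\<close>)
  also have "\<dots> = p ^ n * (\<Sum>k\<le>n. pq_binomial p q n k * ?g n k)"
    unfolding sum_distrib_left using step by (intro sum.cong) auto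
  also have "\<dots> = p ^ (Suc n * (Suc n - 1) div 2)"
    unfolding Suc.IH triangle_Suc by (simp add: power_add)
  finally show ?case .
qed

lemma sum_pq_bernstein:
  assumes "p > q" "q > 0"
  shows "(\<Sum>k\<le>n. pq_bernstein p q n k t) = 1"
proof -
  have "(\<Sum>k\<le>n. pq_bernstein p q n k t) = 1 / p ^ (n * (n - 1) div 2) *
      (\<Sum>k\<le>n. pq_binomial p q n k *
         (p ^ (k * (k - 1) div 2) * t ^ k * (\<Prod>s<n - k. p ^ s - q ^ s * t)))"
    unfolding sum_distrib_left pq_bernstein_def by (simp add: mult.assoc)
  also have "\<dots> = 1"
    unfolding sum_pq_binomial_prod[OF assms] using assms by simp
  finally show ?thesis .
qed

lemma pq_bernstein_nonneg:
  assumes "p > q" "q > 0" "t \<in> {0..1}"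
  shows "pq_bernstein p q n k t \<ge> 0"
proof -
  have "q ^ s * t \<le> p ^ s" for s
  proof -
    have "q ^ s * t \<le> q ^ s"
      using assms by (intro mult_left_le) auto
    also have "\<dots> \<le> p ^ s"
      using assms by (intro power_mono) auto
    finally show ?thesis .
  qed
  then have "(\<Prod>s<n - k. p ^ s - q ^ s * t) \<ge> 0"
    by (intro prod_nonneg) simp
  then show ?thesis
    unfolding pq_bernstein_def using assms pq_binomial_nonneg[OF assms(1,2), of n k] by simp
qed

lemma pq_bernstein_at_0:
  assumes "p > q" "q > 0"
  shows "pq_bernstein p q n k 0 = (if k = 0 then 1 else 0)"
proof (cases "k = 0")
  case True
  \<comment> \<open>All terms with j > 0 contain \<open>0 ^ j\<close>, so the partition of unity
    yields the remaining value without evaluating the product of the \<open>p ^ s\<close>.\<close>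
  have "(\<Sum>j\<le>n. pq_bernstein p q n j 0) = pq_bernstein p q n 0 0"
    by (subst sum.remove[of _ 0]) (auto simp: pq_bernstein_def intro!: sum.neutral)
  with True sum_pq_bernstein[OF assms] show ?thesis by simp
qed (simp add: pq_bernstein_def)

lemma pq_bernstein_at_1:
  assumes "p > q" "q > 0" "k \<le> n"
  shows "pq_bernstein p q n k 1 = (if k = n then 1 else 0)"
proof (cases "k = n")
  case True
  then show ?thesis
    using assms by (simp add: pq_bernstein_def pq_binomial_self)
next
  case False
  \<comment> \<open>For k < n the product includes s = 0, whose factor is 1 - 1.\<close>
  then have "(\<Prod>s<n - k. p ^ s - q ^ s) = 0"
    using \<open>k \<le> n\<close> by (intro prod_zero) (auto intro!: bexI[of _ 0])
  with False show ?thesis by (simp add: pq_bernstein_def)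
qed

lemma pq_bernstein_one: "pq_bernstein 1 q n k t = q_bernstein q n k t"
  by (simp add: pq_bernstein_def q_bernstein_def pq_binomial_def q_binomial_def
      pq_fact_def q_fact_def pq_int_def q_int_def)

lemma pq_bezier_surface_eq_rows:
  "pq_bezier_surface p1 q1 p2 q2 m n P u v =
    (\<Sum>i\<le>m. pq_bernstein p1 q1 m i u *\<^sub>R (\<Sum>j\<le>n. pq_bernstein p2 q2 n j v *\<^sub>R P i j))"
  by (simp add: pq_bezier_surface_def scaleR_sum_right)

lemma pq_bezier_surface_eq_columns:
  "pq_bezier_surface p1 q1 p2 q2 m n P u v =
    (\<Sum>j\<le>n. pq_bernstein p2 q2 n j v *\<^sub>R (\<Sum>i\<le>m. pq_bernstein p1 q1 m i u *\<^sub>R P i j))"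
  unfolding pq_bezier_surface_def
  by (subst sum.swap) (simp add: scaleR_sum_right mult.commute)

lemma convex_combination_imp_affine:
  "convex_combination w I a x \<Longrightarrow> affine_combination w I a x"
  by (simp add: convex_combination_def)

text \<open>The linear part passes through the sum; the translation \<open>b\<close> is reproduced
  because the weights sum to 1.\<close>

lemma affine_combination_affine_map:
  assumes "affine_combination w I a x" "linear f"
  shows "f x + b = (\<Sum>i\<in>I. w i *\<^sub>R (f (a i) + b))"
  using assms
  by (auto simp: affine_combination_def linear_sum linear_cmul scaleR_add_right sum.distrib
      simp flip: scaleR_sum_left)

lemma convex_combination_in_hull:
  assumes "convex_combination w I a x" "a ` I \<subseteq> S"
  shows "x \<in> convex hull S"
  using assms unfolding convex_combination_def affine_combination_def
  by (auto intro!: convex_sum[OF _ convex_convex_hull] intro: hull_inc)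

text \<open>The sum of the weights factors into two univariate partitions of unity. Pairs serve as
  indices so that the double sum becomes a single one.\<close>

lemma convex_combination_pq_bezier_surface:
  assumes "p1 > q1" "q1 > 0" "p2 > q2" "q2 > 0" "u \<in> {0..1}" "v \<in> {0..1}"
  shows "convex_combination (\<lambda>(i, j). pq_bernstein p1 q1 m i u * pq_bernstein p2 q2 n j v)
    ({..m} \<times> {..n}) (\<lambda>(i, j). P i j) (pq_bezier_surface p1 q1 p2 q2 m n P u v)"
proof -
  have "(\<Sum>i\<le>m. \<Sum>j\<le>n. pq_bernstein p1 q1 m i u * pq_bernstein p2 q2 n j v) = 1"
    using assms by (simp add: sum_pq_bernstein flip: sum_product)
  then show ?thesis
    using assms
    by (auto simp: convex_combination_def affine_combination_def pq_bezier_surface_def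
        sum.cartesian_product case_prod_unfold intro!: mult_nonneg_nonneg pq_bernstein_nonneg)
qed

lemma pq_bezier_surface_affine_map:
  assumes "p1 > q1" "q1 > 0" "p2 > q2" "q2 > 0" "u \<in> {0..1}" "v \<in> {0..1}" "linear f"
  shows "f (pq_bezier_surface p1 q1 p2 q2 m n P u v) + b =
    pq_bezier_surface p1 q1 p2 q2 m n (\<lambda>i j. f (P i j) + b) u v"
  using affine_combination_affine_map[OF convex_combination_imp_affine
      [OF convex_combination_pq_bezier_surface[OF assms(1-6), where P = P]] assms(7)]
  by (simp add: pq_bezier_surface_def sum.cartesian_product case_prod_unfold)

lemma pq_bezier_surface_corners:
  assumes "p1 > q1" "q1 > 0" "p2 > q2" "q2 > 0"
  shows "pq_bezier_surface p1 q1 p2 q2 m n P 0 0 = P 0 0"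
    and "pq_bezier_surface p1 q1 p2 q2 m n P 0 1 = P 0 n"
    and "pq_bezier_surface p1 q1 p2 q2 m n P 1 0 = P m 0"
    and "pq_bezier_surface p1 q1 p2 q2 m n P 1 1 = P m n"
  using assms
  \<comment> \<open>Moving \<open>*\<^sub>R\<close> inside the case distinction leaves sums with one
    surviving term; \<open>sum.cong_simp\<close> supplies the index bound required by
    \<open>pq_bernstein_at_1\<close>.\<close>
  by (simp_all add: pq_bezier_surface_eq_rows pq_bernstein_at_0 pq_bernstein_at_1
      if_distrib[of "\<lambda>c. c *\<^sub>R _"] cong: if_cong sum.cong_simp)

theorem mainTheorem7:
  fixes p1 q1 p2 q2 :: real and m n :: nat and P :: "nat \<Rightarrow> nat \<Rightarrow> real ^ 3"
  assumes "p1 > q1" and "q1 > 0" and "p2 > q2" and "q2 > 0"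
  shows
    "(\<comment> \<open>(1) geometric and affine invariance\<close>
      \<forall>u\<in>{0..1}. \<forall>v\<in>{0..1}.
        (\<Sum>i\<le>m. \<Sum>j\<le>n. pq_bernstein p1 q1 m i u * pq_bernstein p2 q2 n j v) = 1
        \<and> affine_combination (\<lambda>(i, j). pq_bernstein p1 q1 m i u * pq_bernstein p2 q2 n j v)
            ({..m} \<times> {..n}) (\<lambda>(i, j). P i j) (pq_bezier_surface p1 q1 p2 q2 m n P u v)
        \<and> (\<forall>(A :: real ^ 3 ^ 3) b.
              A *v pq_bezier_surface p1 q1 p2 q2 m n P u v + b
              = pq_bezier_surface p1 q1 p2 q2 m n (\<lambda>i j. A *v P i j + b) u v))
     \<and> (\<comment> \<open>(2) convex hull property\<close>
      \<forall>u\<in>{0..1}. \<forall>v\<in>{0..1}.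
        convex_combination (\<lambda>(i, j). pq_bernstein p1 q1 m i u * pq_bernstein p2 q2 n j v)
          ({..m} \<times> {..n}) (\<lambda>(i, j). P i j) (pq_bezier_surface p1 q1 p2 q2 m n P u v)
        \<and> pq_bezier_surface p1 q1 p2 q2 m n P u v \<in> convex hull (control_net m n P))
     \<and> (\<comment> \<open>(3) isoparametric curves\<close>
      (\<forall>v\<in>{0..1}.
        is_pq_bezier_curve p1 q1 m (\<lambda>u. pq_bezier_surface p1 q1 p2 q2 m n P u v)
        \<and> (\<forall>u\<in>{0..1}. pq_bezier_surface p1 q1 p2 q2 m n P u v
              = (\<Sum>i\<le>m. pq_bernstein p1 q1 m i u *\<^sub>R (\<Sum>j\<le>n. pq_bernstein p2 q2 n j v *\<^sub>R P i j))))
      \<and> (\<forall>u\<in>{0..1}.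
        is_pq_bezier_curve p2 q2 n (\<lambda>v. pq_bezier_surface p1 q1 p2 q2 m n P u v)
        \<and> (\<forall>v\<in>{0..1}. pq_bezier_surface p1 q1 p2 q2 m n P u v
              = (\<Sum>j\<le>n. pq_bernstein p2 q2 n j v *\<^sub>R (\<Sum>i\<le>m. pq_bernstein p1 q1 m i u *\<^sub>R P i j)))))
     \<and> (\<comment> \<open>(4) corner point interpolation\<close>
      pq_bezier_surface p1 q1 p2 q2 m n P 0 0 = P 0 0
      \<and> pq_bezier_surface p1 q1 p2 q2 m n P 0 1 = P 0 n
      \<and> pq_bezier_surface p1 q1 p2 q2 m n P 1 0 = P m 0
      \<and> pq_bezier_surface p1 q1 p2 q2 m n P 1 1 = P m n)
     \<and> (\<comment> \<open>(5) reducibility\<close>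
      p1 = 1 \<and> p2 = 1 \<longrightarrow>
        (\<forall>u\<in>{0..1}. \<forall>v\<in>{0..1}.
          pq_bezier_surface p1 q1 p2 q2 m n P u v = q_bezier_surface q1 q2 m n P u v))"
proof -
  note comb = convex_combination_pq_bezier_surface[OF assms, where P = P and m = m and n = n]
  \<comment> \<open>The singletons in \<open>control_net\<close> cover every control point, also
    when there are no edges.\<close>
  have "(\<lambda>(i, j). P i j) ` ({..m} \<times> {..n}) \<subseteq> control_net m n P"
    by (auto simp: control_net_def)
  then have hull: "pq_bezier_surface p1 q1 p2 q2 m n P u v \<in> convex hull (control_net m n P)"
    if "u \<in> {0..1}" "v \<in> {0..1}" for u v
    using convex_combination_in_hull[OF comb[OF that]] by blast
  have sum1: "(\<Sum>i\<le>m. \<Sum>j\<le>n. pq_bernstein p1 q1 m i u * pq_bernstein p2 q2 n j v) = 1" for u v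
    using assms by (simp add: sum_pq_bernstein flip: sum_product)
  have rows: "is_pq_bezier_curve p1 q1 m (\<lambda>u. pq_bezier_surface p1 q1 p2 q2 m n P u v)" for v
    unfolding is_pq_bezier_curve_def pq_bezier_curve_def pq_bezier_surface_eq_rows
    \<comment> \<open>The control points of the isoparametric curve are the values at
      \<open>v\<close> of the curves defined by the \<open>P i j\<close> with \<open>i\<close>
      fixed; they do not depend on \<open>u\<close>.\<close>
    by (rule exI[of _ "\<lambda>i. \<Sum>j\<le>n. pq_bernstein p2 q2 n j v *\<^sub>R P i j"]) simp
  have columns: "is_pq_bezier_curve p2 q2 n (\<lambda>v. pq_bezier_surface p1 q1 p2 q2 m n P u v)" for u
    unfolding is_pq_bezier_curve_def pq_bezier_curve_def pq_bezier_surface_eq_columns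
    by (rule exI[of _ "\<lambda>j. \<Sum>i\<le>m. pq_bernstein p1 q1 m i u *\<^sub>R P i j"]) simp
  have reduce: "pq_bezier_surface p1 q1 p2 q2 m n P u v = q_bezier_surface q1 q2 m n P u v"
    if "p1 = 1 \<and> p2 = 1" for u v :: real
    using that by (simp add: pq_bezier_surface_def q_bezier_surface_def pq_bernstein_one)
  show ?thesis
    by (intro conjI ballI allI impI sum1 convex_combination_imp_affine comb hull rows columns
        reduce pq_bezier_surface_eq_rows pq_bezier_surface_eq_columns
        pq_bezier_surface_corners[OF assms]
        pq_bezier_surface_affine_map[OF assms _ _ matrix_vector_mul_linear])
      auto
qed

end
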